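(* Let $Q$ be a smooth $N$-dimensional manifold with local coordinates $x=(x^1,\dots,x^N)$, $\partial_k=\partial/\partial x^k$, and Riemannian metric $G=(G_{jk})$. Let the given independent 1-forms be $\Omega_j=df_j(x)$ for $j=1,\dots,N-1$, and let the remaining arbitrary 1-form also be exact, $\Omega_N=df_N$, with $\Upsilon=\{f_1,\dots,f_{N-1},f_N\}\ne0$. Let $\lambda_N=\lambda_N(x)$ be an arbitrary function and let $$\mathbf v=\frac1\Upsilon\left|\begin{array}{cccc}df_1(\partial_1)&\cdots&df_1(\partial_N)&0\\ \vdots&&\vdots&\vdots\\ df_{N-1}(\partial_1)&\cdots&df_{N-1}(\partial_N)&0\\ df_N(\partial_1)&\cdots&df_N(\partial_N)&\lambda_N\\ \partial_1&\cdots&\partial_N&0\end{array}\right| ,$$ so that $\Omega_N(\mathbf v)=-\lambda_N$. Let $\sigma=\sum_{j,k}G_{jk}v^j\,dx^k$ be the 1-form associated to $\mathbf v$, let $A=(a_{jk}(x))$ be the skew-symmetric matrix with $d\sigma=\frac12\sum_{j,k=1}^Na_{jk}\,\Omega_j\wedge\Omega_k$, and write $\iota_{\mathbf v}d\sigma=\sum_{j=1}^N\Lambda_j\Omega_j$. Then the first order system "$\dot{\mathbf x}=\mathbf v(x)$ under the condition $\Lambda_N=0$" and the second order system $\frac{d}{dt}\frac{\partial T}{\partial\dot x^k}-\frac{\partial T}{\partial x^k}=\frac{\partial}{\partial x^k}\big(\frac12\|\mathbf v\|^2\big)+\sum_{j=1}^{N-1}\Lambda_j\,df_j(\partial_k)$,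 $k=1,\dots,N$, take respectively the form $$\dot{\mathbf x}=-\lambda_N\frac{\{f_1,\dots,f_{N-1},*\}}{\{f_1,\dots,f_{N-1},f_N\}}=\lambda\{f_1,\dots,f_{N-1},*\},$$ $$\frac{d}{dt}\frac{\partial T}{\partial\dot x^k}-\frac{\partial T}{\partial x^k}=\frac{\partial}{\partial x^k}\Big(\tfrac12\|\mathbf v\|^2\Big)+\lambda\sum_{j=1}^{N-1}a_{Nj}\,df_j(\partial_k),\qquad k=1,\dots,N,$$ where $\lambda_N$ is an arbitrary function, $\lambda=-\lambda_N/\{f_1,\dots,f_{N-1},f_N\}$, and $a_{Nj}=a_{Nj}(x)$, $j=1,\dots,N-1$, are elements of the skew-symmetric matrix $A$.
   Context: $\{f_1,\dots,f_{N-1},*\}$ denotes the vector field given by the formal determinant whose first $N-1$ rows are $(df_j(\partial_1),\dots,df_j(\partial_N))$, $j=1,\dots,N-1$, and whose last row is $(\partial_1,\dots,\partial_N)$; $\{f_1,\dots,f_{N-1},f_N\}=\det(\partial_kf_j)$ is the result of applying it to $f_N$. $T=\frac12\|\dot{\mathbf x}\|^2$, where $\|\cdot\|$ is the norm of $G$, and $\iota_{\mathbf v}$ is contraction along $\mathbf v$. All functions and forms are of class $C^\infty$.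
   Formalization: In the second system the coefficient λ before the sum of a_{Nj} df_j(∂_k) is replaced by λΥ = −λ_N, since the printed formula is off by the factor Υ = {f_1,…,f_N} (it fails for f_1 = x^1, f_2 = 2x^2, λ_N = −2x^1 in the Euclidean plane). *)

theory Defs
  imports "HOL-Analysis.Analysis"
begin

section \<open>Smooth functions, manifolds and Riemannian metrics\<close>

abbreviation partial :: "'n \<Rightarrow> (real^'n \<Rightarrow> real) \<Rightarrow> real^'n \<Rightarrow> real" where
  "partial k f x \<equiv> frechet_derivative f (at x) (axis k 1)"

primrec Ck_on :: "nat \<Rightarrow> (real^'n) set \<Rightarrow> (real^'n \<Rightarrow> real) \<Rightarrow> bool" where
  "Ck_on 0 U f \<longleftrightarrow> continuous_on U f"
| "Ck_on (Suc m) U f \<longleftrightarrow> f differentiable_on U \<and> (\<forall>k. Ck_on m U (partial k f))"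

text \<open>Class \<open>C\<^sup>\<infinity>\<close>; only used for open \<open>U\<close>.\<close>

definition smooth_on :: "(real^'n) set \<Rightarrow> (real^'n \<Rightarrow> real) \<Rightarrow> bool" where
  "smooth_on U f \<longleftrightarrow> (\<forall>m. Ck_on m U f)"

type_synonym ('q, 'n) chart = "'q set \<times> ('q \<Rightarrow> real^'n)"

definition transition :: "('q, 'n) chart \<Rightarrow> ('q, 'n) chart \<Rightarrow> real^'n \<Rightarrow> real^'n" where
  "transition c c' = snd c' \<circ> inv_into (fst c) (snd c)"

definition smooth_manifold :: "'q topology \<Rightarrow> ('q, 'n::finite) chart set \<Rightarrow> bool" where
  "smooth_manifold Q \<A> \<longleftrightarrow>
     Hausdorff_space Q \<and> second_countable Q \<and> (\<Union>(D, \<phi>)\<in>\<A>. D) = topspace Q \<and>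
     (\<forall>(D, \<phi>)\<in>\<A>. openin Q D \<and> open (\<phi> ` D) \<and>
        homeomorphic_map (subtopology Q D) (top_of_set (\<phi> ` D)) \<phi>) \<and>
     (\<forall>(D, \<phi>)\<in>\<A>. \<forall>(E, \<psi>)\<in>\<A>. \<forall>k.
        smooth_on (\<phi> ` (D \<inter> E)) (\<lambda>y. transition (D, \<phi>) (E, \<psi>) y $ k))"

text \<open>A metric is given by its component matrices \<open>G c y\<close> in every chart \<open>c\<close>, as functions of the
  coordinates \<open>y\<close> of that chart, transforming as a covariant tensor between charts.\<close>

definition riemannian_metric ::
  "('q, 'n::finite) chart set \<Rightarrow> (('q, 'n) chart \<Rightarrow> real^'n \<Rightarrow> real^'n^'n) \<Rightarrow> bool" where
  "riemannian_metric \<A> G \<longleftrightarrow>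
     (\<forall>(D, \<phi>)\<in>\<A>.
        (\<forall>j k. smooth_on (\<phi> ` D) (\<lambda>y. G (D, \<phi>) y $ j $ k)) \<and>
        (\<forall>y\<in>\<phi> ` D. transpose (G (D, \<phi>) y) = G (D, \<phi>) y \<and>
           (\<forall>u. u \<noteq> 0 \<longrightarrow> 0 < u \<bullet> (G (D, \<phi>) y *v u)))) \<and>
     (\<forall>(D, \<phi>)\<in>\<A>. \<forall>(E, \<psi>)\<in>\<A>. \<forall>y\<in>\<phi> ` (D \<inter> E).
        let \<tau> = transition (D, \<phi>) (E, \<psi>); J = jacobian \<tau> (at y)
        in G (D, \<phi>) y = transpose J ** G (E, \<psi>) (\<tau> y) ** J)"

definition metric_norm :: "real^'n^'n \<Rightarrow> real^'n \<Rightarrow> real" where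
  "metric_norm g u = sqrt (\<Sum>j\<in>UNIV. \<Sum>k\<in>UNIV. g $ j $ k * u $ j * u $ k)"


section \<open>Differential forms in coordinates\<close>

type_synonym 'n form1 = "real^'n \<Rightarrow> real^'n \<Rightarrow> real"
type_synonym 'n form2 = "real^'n \<Rightarrow> real^'n \<Rightarrow> real^'n \<Rightarrow> real"

definition d0 :: "(real^'n \<Rightarrow> real) \<Rightarrow> 'n form1" where
  "d0 f y u = frechet_derivative f (at y) u"

text \<open>\<open>d\<sigma>(u,w) = u(\<sigma>(w)) - w(\<sigma>(u))\<close> for constant vector fields \<open>u\<close>, \<open>w\<close>.\<close>

definition d1 :: "('n::finite) form1 \<Rightarrow> 'n form2" where
  "d1 \<sigma> y u w = frechet_derivative (\<lambda>z. \<sigma> z w) (at y) u - frechet_derivative (\<lambda>z. \<sigma> z u) (at y) w"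

definition wedge :: "('n::finite) form1 \<Rightarrow> 'n form1 \<Rightarrow> 'n form2" where
  "wedge \<alpha> \<beta> y u w = \<alpha> y u * \<beta> y w - \<alpha> y w * \<beta> y u"

definition contract :: "(real^'n \<Rightarrow> real^'n) \<Rightarrow> 'n form2 \<Rightarrow> 'n form1" where
  "contract v \<omega> y u = \<omega> y (v y) u"

definition assoc_form :: "(real^'n \<Rightarrow> real^'n^'n) \<Rightarrow> (real^'n \<Rightarrow> real^'n) \<Rightarrow> 'n form1" where
  "assoc_form g v y u = (\<Sum>j\<in>UNIV. \<Sum>k\<in>UNIV. g y $ j $ k * v y $ j * u $ k)"

definition independent_forms :: "'i set \<Rightarrow> ('i \<Rightarrow> 'n form1) \<Rightarrow> real^'n \<Rightarrow> bool" where
  "independent_forms I \<Omega> y \<longleftrightarrow>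
     (\<forall>c :: 'i \<Rightarrow> real. (\<forall>u. (\<Sum>j\<in>I. c j * \<Omega> j y u) = 0) \<longrightarrow> (\<forall>j\<in>I. c j = 0))"


section \<open>Formal determinants\<close>

text \<open>Leibniz formula for a determinant whose row \<open>r\<close> consists of the vectors \<open>w\<close>, the other rows
  being the scalar rows of \<open>A\<close> (row \<open>r\<close> of \<open>A\<close> is ignored).

  Rows and columns are both indexed by the coordinate type \<open>'n\<close>, with a chosen element \<open>N\<close> in the
  role of the last index. Any enumeration of \<open>'n\<close> ending in \<open>N\<close> yields the same determinants as it
  permutes rows and columns alike.\<close>

definition formal_det :: "'m::finite \<Rightarrow> ('m \<Rightarrow> 'm \<Rightarrow> real) \<Rightarrow> ('m \<Rightarrow> 'b::real_vector) \<Rightarrow> 'b" where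
  "formal_det r A w =
     (\<Sum>p | p permutes UNIV. (of_int (sign p) * (\<Prod>i\<in>UNIV - {r}. A i (p i))) *\<^sub>R w (p r))"

text \<open>\<open>{f\<^sub>1,\<dots>,f\<^sub>N\<^sub>-\<^sub>1,*}\<close> and \<open>{f\<^sub>1,\<dots>,f\<^sub>N}\<close>; the coordinate vector field \<open>\<partial>\<^sub>k\<close> is \<open>axis k 1\<close>.\<close>

definition bracket_field :: "'n::finite \<Rightarrow> ('n \<Rightarrow> real^'n \<Rightarrow> real) \<Rightarrow> real^'n \<Rightarrow> real^'n" where
  "bracket_field N f y = formal_det N (\<lambda>j k. d0 (f j) y (axis k 1)) (\<lambda>k. axis k 1)"

definition bracket :: "('n::finite \<Rightarrow> real^'n \<Rightarrow> real) \<Rightarrow> real^'n \<Rightarrow> real" where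
  "bracket f y = det (\<chi> j k. partial k (f j) y)"

text \<open>The bordered determinant of size \<open>N + 1\<close>: \<open>None\<close> is the additional last row and column.\<close>

definition bordered_field ::
  "'n::finite \<Rightarrow> ('n \<Rightarrow> real^'n \<Rightarrow> real) \<Rightarrow> (real^'n \<Rightarrow> real) \<Rightarrow> real^'n \<Rightarrow> real^'n" where
  "bordered_field N f lamN y =
     formal_det None
       (\<lambda>r c. case r of
           None \<Rightarrow> 0
         | Some j \<Rightarrow> (case c of
               Some k \<Rightarrow> d0 (f j) y (axis k 1)
             | None \<Rightarrow> if j = N then lamN y else 0))
       (\<lambda>c. case c of Some k \<Rightarrow> axis k 1 | None \<Rightarrow> 0)"


section \<open>The two systems of differential equations\<close>

definition solves_first_order ::
  "(real^'n \<Rightarrow> real^'n) \<Rightarrow> real set \<Rightarrow> (real \<Rightarrow> real^'n) \<Rightarrow> bool" where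
  "solves_first_order v J x \<longleftrightarrow> (\<forall>t\<in>J. (x has_vector_derivative v (x t)) (at t))"

definition kinetic :: "(real^'n \<Rightarrow> real^'n^'n) \<Rightarrow> real^'n \<Rightarrow> real^'n \<Rightarrow> real" where
  "kinetic g y u = (metric_norm (g y) u)\<^sup>2 / 2"

text \<open>Lagrange equations with generalised force \<open>F\<close>; \<open>u\<close> is the velocity of \<open>x\<close>.\<close>

definition solves_lagrange ::
  "(real^'n \<Rightarrow> real^'n^'n) \<Rightarrow> (real^'n \<Rightarrow> 'n \<Rightarrow> real) \<Rightarrow> real set \<Rightarrow> (real \<Rightarrow> real^'n) \<Rightarrow> bool" where
  "solves_lagrange g F J x \<longleftrightarrow>
     (\<exists>u. \<forall>t\<in>J. (x has_vector_derivative u t) (at t) \<and>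
        (\<forall>k. \<exists>p'. ((\<lambda>s. partial k (\<lambda>w. kinetic g (x s) w) (u s)) has_real_derivative p') (at t) \<and>
           p' - partial k (\<lambda>y. kinetic g y (u t)) (x t) = F (x t) k))"

end

theory Submission
  imports Defs
begin

text \<open>
  Everything is pointwise linear algebra over the Jacobian matrix \<open>(\<partial>\<^sub>k f\<^sub>j)\<close>, whose determinant \<open>\<Upsilon>\<close>
  does not vanish.

  Replacing row \<open>i\<close> of that determinant by \<open>(\<partial>\<^sub>1,\<dots>,\<partial>\<^sub>N)\<close> gives a vector field \<open>b\<^sub>i\<close> with
  \<open>df\<^sub>j(b\<^sub>i) = \<delta>\<^sub>i\<^sub>j \<Upsilon>\<close>, since pairing with \<open>df\<^sub>j\<close> puts the \<open>j\<close>-th gradient in row \<open>i\<close> and a determinant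
  with two equal rows is zero (\<open>d0_bracket_field\<close>). So the \<open>b\<^sub>i / \<Upsilon>\<close> are the frame dual to the
  \<open>df\<^sub>j\<close>, and \<open>b\<^sub>N = {f\<^sub>1,\<dots>,f\<^sub>N\<^sub>-\<^sub>1,*}\<close>.

  The bordered determinant that defines \<open>\<Upsilon> v\<close> is zero in its last column except for the entry \<open>\<lambda>\<^sub>N\<close>;
  expansion along that column leaves \<open>-\<lambda>\<^sub>N b\<^sub>N\<close> (\<open>bordered_field_eq\<close>). This is the first system, and it
  also gives \<open>df\<^sub>j(v) = -\<lambda>\<^sub>N \<delta>\<^sub>j\<^sub>N\<close>. Contracting \<open>d\<sigma> = 1/2 \<Sum> a\<^sub>j\<^sub>k df\<^sub>j \<and> df\<^sub>k\<close> with such a \<open>v\<close> leaves, by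
  skew-symmetry of \<open>A\<close>, only row \<open>N\<close> of \<open>A\<close>: \<open>\<iota>\<^sub>v d\<sigma> = -\<lambda>\<^sub>N \<Sum> a\<^sub>N\<^sub>j df\<^sub>j\<close>. Evaluating on the dual frame,
  \<open>\<Lambda>\<^sub>j = -\<lambda>\<^sub>N a\<^sub>N\<^sub>j = \<lambda> \<Upsilon> a\<^sub>N\<^sub>j\<close>. Hence the forces of the two second order systems agree, and \<open>\<Lambda>\<^sub>N = 0\<close>
  holds of itself because \<open>a\<^sub>N\<^sub>N = 0\<close>.
\<close>

section \<open>The dual frame\<close>

lemma formal_det_linear:
  assumes "linear L"
  shows "L (formal_det r A w) = formal_det r A (\<lambda>k. L (w k))"
  unfolding formal_det_def
  by (simp add: linear_sum[OF assms] linear_cmul[OF assms])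

lemma formal_det_real:
  fixes w :: "'m::finite \<Rightarrow> real"
  shows "formal_det r A w = det (\<chi> i k. if i = r then w k else A i k)"
  unfolding formal_det_def det_def
proof (rule sum.cong[OF refl])
  fix p :: "'m \<Rightarrow> 'm"
  have "(\<Prod>i\<in>UNIV. (\<chi> i k. if i = r then w k else A i k) $ i $ p i)
      = w (p r) * (\<Prod>i\<in>UNIV - {r}. A i (p i))"
    by (subst prod.remove[of _ r]) (auto intro!: prod.cong)
  then show "(of_int (sign p) * (\<Prod>i\<in>UNIV - {r}. A i (p i))) *\<^sub>R w (p r)
      = of_int (sign p) * (\<Prod>i\<in>UNIV. (\<chi> i k. if i = r then w k else A i k) $ i $ p i)"
    by simp
qed

text \<open>Row \<open>i\<close> is the one replaced by the coordinate fields, for any \<open>i\<close>: only \<open>i = N\<close> occurs in the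
  equations of motion, but all \<open>i\<close> together form the dual frame that isolates single coefficients of a
  1-form.\<close>

lemma d0_bracket_field:
  fixes f :: "'n::finite \<Rightarrow> real^'n \<Rightarrow> real"
  assumes "f j differentiable (at y)"
  shows "d0 (f j) y (bracket_field i f y) = (if j = i then bracket f y else 0)"
proof -
  have "d0 (f j) y (bracket_field i f y)
      = det (\<chi> r k. if r = i then d0 (f j) y (axis k 1) else d0 (f r) y (axis k 1))"
    unfolding bracket_field_def formal_det_real[symmetric]
    by (rule formal_det_linear) (use linear_frechet_derivative[OF assms] in \<open>simp add: d0_def[abs_def]\<close>)
  also have "\<dots> = (if j = i then bracket f y else 0)"
  proof (cases "j = i")
    case True
    then have "(\<chi> r k. if r = i then d0 (f j) y (axis k 1) else d0 (f r) y (axis k 1))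
             = (\<chi> r k. partial k (f r) y)"
      by (simp add: vec_eq_iff d0_def)
    with True show ?thesis
      by (simp add: bracket_def)
  next
    case False
    then show ?thesis
      by (auto intro!: det_identical_rows[of j i] simp: row_def vec_eq_iff)
  qed
  finally show ?thesis .
qed

section \<open>The bordered determinant\<close>

text \<open>
  The terms of the bordered determinant that survive are those of permutations \<open>p\<close> with
  \<open>p (Some N) = None\<close>. Undoing the exchange of rows \<open>None\<close> and \<open>Some N\<close> turns such a \<open>p\<close> into
  \<open>map_option q\<close> for a permutation \<open>q\<close> of the original indices; the exchange costs one sign, and row
  \<open>N\<close> of the smaller determinant inherits the vectors of the border.
\<close>

lemma formal_det_border:
  fixes N :: "'m::finite" and w :: "'m option \<Rightarrow> 'b::real_vector"
  assumes w0: "w None = 0" and A: "\<And>j. A (Some j) None = (if j = N then l else 0)"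
  shows "formal_det None A w = - l *\<^sub>R formal_det N (\<lambda>j k. A (Some j) (Some k)) (\<lambda>k. w (Some k))"
proof -
  let ?t = "Transposition.transpose None (Some N)"
  define border where "border q = map_option q \<circ> ?t" for q :: "'m \<Rightarrow> 'm"
  define unborder where "unborder p = (\<lambda>k. the ((p \<circ> ?t) (Some k)))" for p :: "'m option \<Rightarrow> 'm option"
  have prod_Some: "(\<Prod>i\<in>UNIV - {None}. A i (p i)) = (\<Prod>j\<in>UNIV. A (Some j) (p (Some j)))"
    for p :: "'m option \<Rightarrow> 'm option"
  proof -
    have "UNIV - {None} = range (Some :: 'm \<Rightarrow> _)"
      by (auto simp: UNIV_option_conv)
    then show ?thesis
      by (simp add: prod.reindex)
  qed
  have lift_eq: "map_permutation UNIV Some q = map_option q" if "q permutes UNIV" for q :: "'m \<Rightarrow> 'm"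
  proof
    fix i show "map_permutation UNIV Some q i = map_option q i"
      by (cases i) (auto simp: map_permutation_apply map_permutation_def restrict_id_def)
  qed
  have lift: "map_option q permutes UNIV" "sign (map_option q) = sign q"
    if "q permutes UNIV" for q :: "'m \<Rightarrow> 'm"
  proof -
    have "map_permutation UNIV Some q permutes range Some"
      by (rule map_permutation_permutes) (use that in \<open>auto intro: inj_on_imp_bij_betw\<close>)
    then show "map_option q permutes UNIV"
      unfolding lift_eq[OF that] by (rule permutes_subset) simp
    show "sign (map_option q) = sign q"
      using sign_map_permutation[of Some UNIV q] that by (simp add: lift_eq[OF that])
  qed
  have t: "?t permutes UNIV"
    by (rule permutes_swap_id) auto
  have border: "border q permutes UNIV" "sign (border q) = - sign q" if "q permutes UNIV" for q
  proof -
    show "border q permutes UNIV"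
      unfolding border_def by (rule permutes_compose[OF t lift(1)[OF that]])
    show "sign (border q) = - sign q"
      unfolding border_def
      using lift[OF that] t permutation_permutes[of "map_option q"] permutation_permutes[of ?t]
      by (subst sign_compose) (auto simp: sign_swap_id)
  qed
  have border_unborder: "border (unborder p) = p" and unborder: "unborder p permutes UNIV"
    if p: "p permutes UNIV" and pN: "p (Some N) = None" for p
  proof -
    have inj: "inj p" using p by (rule permutes_inj)
    have notNone: "p (?t (Some k)) \<noteq> None" for k
    proof
      assume "p (?t (Some k)) = None"
      then have "?t (Some k) = Some N"
        using pN inj by (metis injD)
      then show False
        by (auto simp: Transposition.transpose_def split: if_splits)
    qed
    show eq: "border (unborder p) = p"
    proof
      fix i show "border (unborder p) i = p i"
      proof (cases "?t i")
        case None
        then have "i = Some N"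
          by (auto simp: Transposition.transpose_def split: if_splits)
        then show ?thesis
          by (simp add: border_def pN)
      next
        case (Some k)
        then have "?t (Some k) = i"
          by (metis transpose_involutory)
        then show ?thesis
          using Some notNone[of k] by (simp add: border_def unborder_def)
      qed
    qed
    have "inj (unborder p)"
    proof (rule injI)
      fix j k assume "unborder p j = unborder p k"
      then have "p (?t (Some j)) = p (?t (Some k))"
        using notNone[of j] notNone[of k] by (auto simp: unborder_def)
      then show "j = k"
        using inj by (metis injD option.inject transpose_involutory)
    qed
    then show "unborder p permutes UNIV"
      by (intro bij_imp_permutes) (auto simp: bij_betw_def finite_UNIV_inj_surj)
  qed
  have "formal_det None A w
      = (\<Sum>p | p permutes UNIV \<and> p (Some N) = None.
           (of_int (sign p) * (\<Prod>j\<in>UNIV. A (Some j) (p (Some j)))) *\<^sub>R w (p None))"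
    unfolding formal_det_def prod_Some
  proof (rule sum.mono_neutral_right)
    have "(of_int (sign p) * (\<Prod>j\<in>UNIV. A (Some j) (p (Some j)))) *\<^sub>R w (p None) = 0"
      if p: "p permutes UNIV" and pN: "p (Some N) \<noteq> None" for p :: "'m option \<Rightarrow> 'm option"
      \<comment> \<open>Such a \<open>p\<close> meets column \<open>None\<close> in the border row or in a row \<open>Some j\<close> with \<open>j \<noteq> N\<close>, and the
        entry there is zero.\<close>
    proof (cases "w (p None) = 0")
      case False
      obtain i where i: "p i = None"
        using permutes_surj[OF p] by (metis surjD)
      with False w0 obtain j where "i = Some j"
        by (cases i) auto
      with i pN have "A (Some j) (p (Some j)) = 0"
        by (auto simp: A)
      then have "(\<Prod>j\<in>UNIV. A (Some j) (p (Some j))) = 0"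
        by (intro prod_zero) auto
      then show ?thesis by simp
    qed simp
    then show "\<forall>p\<in>{p. p permutes UNIV} - {p. p permutes UNIV \<and> p (Some N) = None}.
        (of_int (sign p) * (\<Prod>j\<in>UNIV. A (Some j) (p (Some j)))) *\<^sub>R w (p None) = 0"
      by blast
  qed (auto simp: finite_permutations)
  also have "\<dots> = (\<Sum>q | q permutes UNIV. - l *\<^sub>R
      ((of_int (sign q) * (\<Prod>j\<in>UNIV - {N}. A (Some j) (Some (q j)))) *\<^sub>R w (Some (q N))))"
  proof (rule sum.reindex_bij_witness[of _ border unborder])
    fix p assume "p \<in> {p. p permutes UNIV \<and> p (Some N) = None}"
    then have p: "p permutes UNIV" "p (Some N) = None" by auto
    let ?q = "unborder p"
    show "border ?q = p" and "?q \<in> {q. q permutes UNIV}"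
      using p border_unborder unborder by auto
    have pj: "p (Some j) = Some (?q j)" if "j \<noteq> N" for j
      using that fun_cong[OF border_unborder[OF p], of "Some j"] by (simp add: border_def)
    have pNone: "p None = Some (?q N)"
      using fun_cong[OF border_unborder[OF p], of None] by (simp add: border_def)
    have sgn: "sign p = - sign ?q"
      using border(2)[OF unborder[OF p]] border_unborder[OF p] by simp
    have "(\<Prod>j\<in>UNIV. A (Some j) (p (Some j))) = l * (\<Prod>j\<in>UNIV - {N}. A (Some j) (Some (?q j)))"
      by (subst prod.remove[of _ N]) (auto simp: p(2) A pj intro!: prod.cong)
    then show "- l *\<^sub>R ((of_int (sign ?q) * (\<Prod>j\<in>UNIV - {N}. A (Some j) (Some (?q j)))) *\<^sub>R w (Some (?q N)))
        = (of_int (sign p) * (\<Prod>j\<in>UNIV. A (Some j) (p (Some j)))) *\<^sub>R w (p None)"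
      by (simp add: sgn pNone)
  next
    fix q :: "'m \<Rightarrow> 'm" assume "q \<in> {q. q permutes UNIV}"
    then show "border q \<in> {p. p permutes UNIV \<and> p (Some N) = None}"
      using border(1) by (auto simp: border_def)
    show "unborder (border q) = q"
      by (auto simp: fun_eq_iff border_def unborder_def)
  qed
  finally show ?thesis
    by (simp add: formal_det_def scaleR_sum_right)
qed

lemma bordered_field_eq: "bordered_field N f lamN y = - lamN y *\<^sub>R bracket_field N f y"
  unfolding bordered_field_def bracket_field_def
  by (subst formal_det_border[where N = N and l = "lamN y"]) auto

section \<open>Contraction with a skew-symmetric 2-form\<close>

lemma skew_matrix_component:
  fixes a :: "real^'n^'n"
  assumes "transpose a = - a"
  shows "a $ j $ k = - a $ k $ j"
proof -
  have "transpose a $ k $ j = (- a) $ k $ j"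
    using assms by simp
  then show ?thesis
    by (simp add: transpose_def)
qed

text \<open>The two halves of the wedge product contribute row \<open>N\<close> and column \<open>N\<close> of \<open>a\<close>; by
  skew-symmetry they are equal, which cancels the factor one half.\<close>

lemma skew_contraction:
  fixes a :: "real^'n^'n" and \<alpha> \<beta> :: "'n::finite \<Rightarrow> real"
  assumes skew: "transpose a = - a" and \<alpha>: "\<And>j. \<alpha> j = (if j = N then c else 0)"
  shows "1/2 * (\<Sum>j\<in>UNIV. \<Sum>k\<in>UNIV. a $ j $ k * (\<alpha> j * \<beta> k - \<beta> j * \<alpha> k))
       = c * (\<Sum>k\<in>UNIV. a $ N $ k * \<beta> k)"
proof -
  have 1: "(\<Sum>j\<in>UNIV. \<Sum>k\<in>UNIV. a $ j $ k * (\<alpha> j * \<beta> k)) = c * (\<Sum>k\<in>UNIV. a $ N $ k * \<beta> k)"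
  proof -
    have "(\<Sum>k\<in>UNIV. a $ j $ k * (\<alpha> j * \<beta> k))
        = (if j = N then c * (\<Sum>k\<in>UNIV. a $ N $ k * \<beta> k) else 0)" for j
      by (simp add: \<alpha> sum_distrib_left mult_ac)
    then show ?thesis by simp
  qed
  have "(\<Sum>j\<in>UNIV. \<Sum>k\<in>UNIV. a $ j $ k * (\<beta> j * \<alpha> k))
      = (\<Sum>k\<in>UNIV. \<Sum>j\<in>UNIV. - (a $ k $ j * (\<alpha> k * \<beta> j)))"
    by (subst sum.swap) (intro sum.cong refl, subst skew_matrix_component[OF skew], simp)
  then have 2: "(\<Sum>j\<in>UNIV. \<Sum>k\<in>UNIV. a $ j $ k * (\<beta> j * \<alpha> k)) = - (c * (\<Sum>k\<in>UNIV. a $ N $ k * \<beta> k))"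
    using 1 by (simp add: sum_negf)
  show ?thesis
    by (simp only: right_diff_distrib sum_subtractf 1 2)
qed

section \<open>The two systems\<close>

lemma smooth_on_imp_differentiable:
  assumes "smooth_on U h" "open U" "y \<in> U"
  shows "h differentiable (at y)"
proof -
  have "Ck_on (Suc 0) U h"
    using assms(1) unfolding smooth_on_def by blast
  then have "h differentiable_on U"
    by simp
  with assms(2,3) show ?thesis
    by (simp add: differentiable_on_eq_differentiable_at)
qed

lemma solves_first_order_cong:
  assumes "\<And>y. y \<in> U \<Longrightarrow> V y = W y" and "x ` J \<subseteq> U"
  shows "solves_first_order V J x \<longleftrightarrow> solves_first_order W J x"
  using assms unfolding solves_first_order_def by (metis image_subset_iff)

lemma solves_lagrange_cong:
  assumes F: "\<And>y k. y \<in> U \<Longrightarrow> F y k = F' y k" and x: "x ` J \<subseteq> U"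
  shows "solves_lagrange g F J x \<longleftrightarrow> solves_lagrange g F' J x"
proof -
  have "F (x t) k = F' (x t) k" if "t \<in> J" for t k
    using F x that by blast
  then show ?thesis
    unfolding solves_lagrange_def by simp
qed

theorem corollary1p4:
  fixes Q :: "'q topology"
    and \<A> :: "('q, 'n::finite) chart set"
    and G :: "('q, 'n) chart \<Rightarrow> real^'n \<Rightarrow> real^'n^'n"
    and D :: "'q set" and \<phi> :: "'q \<Rightarrow> real^'n" and U :: "(real^'n) set"
    and g :: "real^'n \<Rightarrow> real^'n^'n"
    and N :: 'n
    and f :: "'n \<Rightarrow> real^'n \<Rightarrow> real"
    and lamN \<Upsilon> lam :: "real^'n \<Rightarrow> real"
    and v :: "real^'n \<Rightarrow> real^'n"
    and \<sigma> :: "'n form1"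
    and a :: "real^'n \<Rightarrow> real^'n^'n"
    and \<Lambda> :: "'n \<Rightarrow> real^'n \<Rightarrow> real"
  assumes "smooth_manifold Q \<A>" and "riemannian_metric \<A> G"
    and "(D, \<phi>) \<in> \<A>" and "U = \<phi> ` D" and "g = G (D, \<phi>)"
    and "\<And>j. smooth_on U (f j)" and "smooth_on U lamN"
    and "\<And>y. y \<in> U \<Longrightarrow> independent_forms (UNIV - {N}) (\<lambda>j. d0 (f j)) y"
    and "\<Upsilon> = bracket f"
    and "\<And>y. y \<in> U \<Longrightarrow> \<Upsilon> y \<noteq> 0"
    and "v = (\<lambda>y. (1 / \<Upsilon> y) *\<^sub>R bordered_field N f lamN y)"
    and "\<sigma> = assoc_form g v"
    and "\<And>y. y \<in> U \<Longrightarrow> transpose (a y) = - a y"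
    and "\<And>y u w. y \<in> U \<Longrightarrow>
           d1 \<sigma> y u w = 1/2 * (\<Sum>j\<in>UNIV. \<Sum>k\<in>UNIV. a y $ j $ k * wedge (d0 (f j)) (d0 (f k)) y u w)"
    and "\<And>y u. y \<in> U \<Longrightarrow> contract v (d1 \<sigma>) y u = (\<Sum>j\<in>UNIV. \<Lambda> j y * d0 (f j) y u)"
    and "lam = (\<lambda>y. - lamN y / \<Upsilon> y)"
  shows
    "let V\<^sub>1 = (\<lambda>y. - lamN y *\<^sub>R ((1 / \<Upsilon> y) *\<^sub>R bracket_field N f y));
         V\<^sub>2 = (\<lambda>y. lam y *\<^sub>R bracket_field N f y);
         F = (\<lambda>y k. partial k (\<lambda>z. (metric_norm (g z) (v z))\<^sup>2 / 2) y
                 + (\<Sum>j\<in>UNIV - {N}. \<Lambda> j y * d0 (f j) y (axis k 1)));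
         F' = (\<lambda>y k. partial k (\<lambda>z. (metric_norm (g z) (v z))\<^sup>2 / 2) y
                 + lam y * \<Upsilon> y * (\<Sum>j\<in>UNIV - {N}. a y $ N $ j * d0 (f j) y (axis k 1)))
     in (\<forall>y\<in>U. v y = V\<^sub>1 y \<and> V\<^sub>1 y = V\<^sub>2 y) \<and>
        (\<forall>y\<in>U. \<forall>k. F y k = F' y k) \<and>
        (\<forall>J \<gamma> x. open J \<and> is_interval J \<and> \<gamma> ` J \<subseteq> D \<and> x = \<phi> \<circ> \<gamma> \<longrightarrow>
           (solves_first_order v J x \<and> (\<forall>y\<in>U. \<Lambda> N y = 0) \<longleftrightarrow> solves_first_order V\<^sub>1 J x) \<and>
           (solves_first_order V\<^sub>1 J x \<longleftrightarrow> solves_first_order V\<^sub>2 J x) \<and>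
           (solves_lagrange g F J x \<longleftrightarrow> solves_lagrange g F' J x))"
proof -
  have openU: "open U"
    using assms(1,3,4) unfolding smooth_manifold_def by blast
  have diff: "f j differentiable (at y)" if "y \<in> U" for j y
    using smooth_on_imp_differentiable[OF assms(6) openU that] .
  have v: "v y = (- lamN y / \<Upsilon> y) *\<^sub>R bracket_field N f y" for y
    by (simp add: assms(11) bordered_field_eq)
  have dfv: "d0 (f j) y (v y) = (if j = N then - lamN y else 0)" if y: "y \<in> U" for j y
  proof -
    have "d0 (f j) y (v y) = (- lamN y / \<Upsilon> y) * d0 (f j) y (bracket_field N f y)"
      unfolding v d0_def by (simp only: linear_cmul[OF linear_frechet_derivative[OF diff[OF y]]] real_scaleR_def)
    then show ?thesis
      using assms(10)[OF y] by (simp add: d0_bracket_field[of f, OF diff[OF y]] assms(9))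
  qed
  have contr: "(\<Sum>j\<in>UNIV. \<Lambda> j y * d0 (f j) y u) = - lamN y * (\<Sum>k\<in>UNIV. a y $ N $ k * d0 (f k) y u)"
    if y: "y \<in> U" for y u
    using skew_contraction[OF assms(13)[OF y] dfv[OF y], of "\<lambda>k. d0 (f k) y u"]
      assms(14)[OF y, of "v y" u] assms(15)[OF y, of u]
    by (simp add: contract_def wedge_def)
  have \<Lambda>: "\<Lambda> i y = - lamN y * a y $ N $ i" if y: "y \<in> U" for i y
  proof -
    \<comment> \<open>Both sides of the previous identity, evaluated on the \<open>i\<close>-th dual field, keep one term each.\<close>
    have "\<Lambda> i y * \<Upsilon> y = (- lamN y * a y $ N $ i) * \<Upsilon> y"
      using contr[OF y, of "bracket_field i f y"]
      by (simp add: d0_bracket_field[of f, OF diff[OF y]] assms(9) if_distrib cong: if_cong)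
    then show ?thesis
      unfolding mult_right_cancel[OF assms(10)[OF y]] .
  qed
  have \<Lambda>N: "\<Lambda> N y = 0" if y: "y \<in> U" for y
    using skew_matrix_component[OF assms(13)[OF y], of N N] by (simp add: \<Lambda>[OF y])
  define V\<^sub>1 where "V\<^sub>1 = (\<lambda>y. - lamN y *\<^sub>R ((1 / \<Upsilon> y) *\<^sub>R bracket_field N f y))"
  define V\<^sub>2 where "V\<^sub>2 = (\<lambda>y. lam y *\<^sub>R bracket_field N f y)"
  define F where "F = (\<lambda>y k. partial k (\<lambda>z. (metric_norm (g z) (v z))\<^sup>2 / 2) y
      + (\<Sum>j\<in>UNIV - {N}. \<Lambda> j y * d0 (f j) y (axis k 1)))"
  define F' where "F' = (\<lambda>y k. partial k (\<lambda>z. (metric_norm (g z) (v z))\<^sup>2 / 2) y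
      + lam y * \<Upsilon> y * (\<Sum>j\<in>UNIV - {N}. a y $ N $ j * d0 (f j) y (axis k 1)))"
  have V: "v y = V\<^sub>1 y" "V\<^sub>1 y = V\<^sub>2 y" for y
    by (simp_all add: v V\<^sub>1_def V\<^sub>2_def assms(16))
  have F: "F y k = F' y k" if y: "y \<in> U" for y k
  proof -
    have "lam y * \<Upsilon> y = - lamN y"
      using assms(10)[OF y] by (simp add: assms(16))
    then show ?thesis
      unfolding F_def F'_def by (simp add: \<Lambda>[OF y] sum_distrib_left mult.assoc)
  qed
  have "(solves_first_order v J x \<and> (\<forall>y\<in>U. \<Lambda> N y = 0) \<longleftrightarrow> solves_first_order V\<^sub>1 J x) \<and>
      (solves_first_order V\<^sub>1 J x \<longleftrightarrow> solves_first_order V\<^sub>2 J x) \<and>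
      (solves_lagrange g F J x \<longleftrightarrow> solves_lagrange g F' J x)"
    if "\<gamma> ` J \<subseteq> D" "x = \<phi> \<circ> \<gamma>" for J \<gamma> x
  proof -
    have x: "x ` J \<subseteq> U"
      using that assms(4) by auto
    show ?thesis
      using solves_first_order_cong[of U v V\<^sub>1, OF V(1) x] solves_first_order_cong[of U V\<^sub>1 V\<^sub>2, OF V(2) x]
        solves_lagrange_cong[of U F F', OF F x] \<Lambda>N
      by blast
  qed
  then show ?thesis
    unfolding Let_def F_def[symmetric] F'_def[symmetric] V\<^sub>1_def[symmetric] V\<^sub>2_def[symmetric]
    using V F by blast
qed

end
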